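(* For each finite nonempty set $V$ let $\mathrm{MG}^{\bullet}_{or}[V]$ be the $\mathbb{K}$-vector space with basis the pairs $(g,v)$ where $g$ is an oriented multigraph on $V$ and $v\in V$ (and let $\mathrm{MG}^{\bullet}_{or}[\emptyset]=\{0\}$). For disjoint finite sets $V_1,V_2$, $*\notin V_1\sqcup V_2$, and basis elements $(g_1,v_1)\in \mathrm{MG}^{\bullet}_{or}[V_1\sqcup\{*\}]$, $(g_2,v_2)\in \mathrm{MG}^{\bullet}_{or}[V_2]$, define $(g_1,v_1)\circ_*(g_2,v_2)$ as the sum (with multiplicity) over all elements obtained as follows: take the disjoint union of $g_1$ and $g_2$; remove the vertex $*$, so that some edges have loose ends; connect each loose source end to $v_2$; connect each loose target end to any vertex of $V_2$ (each loose target end independently, and one sums over all choices); the new root is $v_1$ if $v_1\neq *$ and $v_2$ if $v_1=*$. Extend bilinearly. Then the species $\mathrm{MG}^{\bullet}_{or}$ endowed with this partial composition (with units the edgeless graph on $\{v\}$ pointed at $v$) is an operad.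
   Context: $\mathbb{K}$ is a field of characteristic $0$. A (linear) species $S$ is a functor from finite sets with bijections to $\mathbb{K}$-vector spaces, $V\mapsto S[V]$, $\sigma\mapsto S[\sigma]$. An operad is a species $O$ with $O[\emptyset]=\{0\}$, units $e(v)\in O[\{v\}]$ (natural in $v$), and bilinear maps $\circ_*:O[V_1\sqcup\{*\}]\times O[V_2]\to O[V_1\sqcup V_2]$ (partial compositions, for disjoint finite sets $V_1$, $V_2$ and $*\notin V_1\sqcup V_2$), natural with respect to bijections, such that (i) $(x\circ_{*_1}y)\circ_{*_2}z=(x\circ_{*_2}z)\circ_{*_1}y$ for $x\in O[V_1\sqcup\{*_1,*_2\}]$, $y\in O[V_2]$, $z\in O[V_3]$; (ii) $(x\circ_{*_1}y)\circ_{*_2}z=x\circ_{*_1}(y\circ_{*_2}z)$ for $x\in O[V_1\sqcup\{*_1\}]$, $y\in O[V_2\sqcup\{*_2\}]$, $z\in O[V_3]$; (iii) $x\circ_* e(v)=O[\sigma](x)$, where $\sigma$ sends $*$ to $v$ and is the identity elsewhere, and $e( * )\circ_* x=x$. A multigraph on $V$ is a finite multiset of unordered pairs $\{u,v\}$ of (possibly equal) elements of $V$, called edges; the two vertices of an edge are its two ends (a loop has two ends at the same vertex). An oriented multigraph is a multigraph in which each end of each edge is labelled either "source" or "target" (both ends of an edge may carry the same label); equivalently, a finite multiset of unordered pairs of elements of $V\times\{\mathtt{s},\mathtt{t}\}$. When an end is reconnected it keeps its label. *)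

theory Defs
  imports Complex_Main "HOL-Library.Multiset" "HOL-Library.Uprod" "HOL-Library.FuncSet"
    "HOL-Library.Poly_Mapping"
begin

text \<open>
  Finite sets are the finite subsets of a type \<open>'v\<close>, which remains arbitrary throughout.
  The values of a species are subspaces \<open>S V\<close> of one ambient vector space \<open>'x\<close>
  (subspaces for different \<open>V\<close> may overlap).  A bijection is a function on the
  whole type, of which only the values on its domain matter: \<open>act V \<sigma>\<close> is the map
  \<open>S[\<sigma>]\<close> from \<open>S V\<close> to \<open>S (\<sigma> ` V)\<close>, and its dependence on \<open>\<sigma>\<close> is
  restricted to \<open>V\<close> by the axiom \<open>act_cong\<close>.  The values of \<open>act V \<sigma>\<close> outside \<open>S V\<close>
  are irrelevant.
\<close>

locale species = vector_space scale
  for scale :: "'k::field_char_0 \<Rightarrow> 'x::ab_group_add \<Rightarrow> 'x" (infixr \<open>*s\<close> 75) +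
  fixes S :: "'v set \<Rightarrow> 'x set"
    and act :: "'v set \<Rightarrow> ('v \<Rightarrow> 'v) \<Rightarrow> 'x \<Rightarrow> 'x"
  assumes subspace_S: "finite V \<Longrightarrow> subspace (S V)"
    and act_closed: "\<lbrakk>finite V; bij_betw \<sigma> V W; x \<in> S V\<rbrakk> \<Longrightarrow> act V \<sigma> x \<in> S W"
    and act_add: "\<lbrakk>finite V; inj_on \<sigma> V; x \<in> S V; y \<in> S V\<rbrakk>
      \<Longrightarrow> act V \<sigma> (x + y) = act V \<sigma> x + act V \<sigma> y"
    and act_scale: "\<lbrakk>finite V; inj_on \<sigma> V; x \<in> S V\<rbrakk> \<Longrightarrow> act V \<sigma> (c *s x) = c *s act V \<sigma> x"
    and act_cong: "\<lbrakk>finite V; inj_on \<sigma> V; \<And>v. v \<in> V \<Longrightarrow> \<sigma> v = \<tau> v; x \<in> S V\<rbrakk>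
      \<Longrightarrow> act V \<sigma> x = act V \<tau> x"
    and act_id: "\<lbrakk>finite V; x \<in> S V\<rbrakk> \<Longrightarrow> act V id x = x"
    and act_comp: "\<lbrakk>finite V; bij_betw \<sigma> V W; inj_on \<tau> W; x \<in> S V\<rbrakk>
      \<Longrightarrow> act V (\<tau> \<circ> \<sigma>) x = act W \<tau> (act V \<sigma> x)"

text \<open>
  The condition under which the partial composition
  \<open>O[V\<^sub>1 \<squnion> {s}] \<times> O[V\<^sub>2] \<rightarrow> O[V\<^sub>1 \<squnion> V\<^sub>2]\<close> at the point \<open>s\<close> is defined.
\<close>

definition composable :: "'v set \<Rightarrow> 'v set \<Rightarrow> 'v \<Rightarrow> bool" where
  "composable V1 V2 s \<longleftrightarrow> finite V1 \<and> finite V2 \<and> V1 \<inter> V2 = {} \<and> s \<notin> V1 \<union> V2"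

text \<open>
  \<open>pcomp V\<^sub>1 V\<^sub>2 s x y\<close> is \<open>x \<circ>\<^sub>s y\<close> for \<open>x \<in> O[V\<^sub>1 \<squnion> {s}]\<close> and \<open>y \<in> O[V\<^sub>2]\<close>.
\<close>

locale operad = species scale S act
  for scale :: "'k::field_char_0 \<Rightarrow> 'x::ab_group_add \<Rightarrow> 'x" (infixr \<open>*s\<close> 75)
    and S :: "'v set \<Rightarrow> 'x set"
    and act :: "'v set \<Rightarrow> ('v \<Rightarrow> 'v) \<Rightarrow> 'x \<Rightarrow> 'x" +
  fixes unit :: "'v \<Rightarrow> 'x"
    and pcomp :: "'v set \<Rightarrow> 'v set \<Rightarrow> 'v \<Rightarrow> 'x \<Rightarrow> 'x \<Rightarrow> 'x"
  assumes S_empty: "S {} = {0}"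
    and unit_in: "unit v \<in> S {v}"
    and unit_natural: "act {v} \<sigma> (unit v) = unit (\<sigma> v)"
    and pcomp_closed: "\<lbrakk>composable V1 V2 s; x \<in> S (insert s V1); y \<in> S V2\<rbrakk>
      \<Longrightarrow> pcomp V1 V2 s x y \<in> S (V1 \<union> V2)"
    and pcomp_add_left: "\<lbrakk>composable V1 V2 s; x \<in> S (insert s V1); x' \<in> S (insert s V1); y \<in> S V2\<rbrakk>
      \<Longrightarrow> pcomp V1 V2 s (x + x') y = pcomp V1 V2 s x y + pcomp V1 V2 s x' y"
    and pcomp_scale_left: "\<lbrakk>composable V1 V2 s; x \<in> S (insert s V1); y \<in> S V2\<rbrakk>
      \<Longrightarrow> pcomp V1 V2 s (c *s x) y = c *s pcomp V1 V2 s x y"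
    and pcomp_add_right: "\<lbrakk>composable V1 V2 s; x \<in> S (insert s V1); y \<in> S V2; y' \<in> S V2\<rbrakk>
      \<Longrightarrow> pcomp V1 V2 s x (y + y') = pcomp V1 V2 s x y + pcomp V1 V2 s x y'"
    and pcomp_scale_right: "\<lbrakk>composable V1 V2 s; x \<in> S (insert s V1); y \<in> S V2\<rbrakk>
      \<Longrightarrow> pcomp V1 V2 s x (c *s y) = c *s pcomp V1 V2 s x y"
    and pcomp_natural:
      "\<lbrakk>composable V1 V2 s; composable W1 W2 s';
        bij_betw \<sigma> V1 W1; \<sigma> s = s'; bij_betw \<tau> V2 W2; x \<in> S (insert s V1); y \<in> S V2\<rbrakk>
      \<Longrightarrow> act (V1 \<union> V2) (\<lambda>v. if v \<in> V1 then \<sigma> v else \<tau> v) (pcomp V1 V2 s x y)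
        = pcomp W1 W2 s' (act (insert s V1) \<sigma> x) (act V2 \<tau> y)"
    and pcomp_parallel:
      "\<lbrakk>finite V1; finite V2; finite V3; V1 \<inter> V2 = {}; V1 \<inter> V3 = {}; V2 \<inter> V3 = {};
        s1 \<noteq> s2; s1 \<notin> V1 \<union> V2 \<union> V3; s2 \<notin> V1 \<union> V2 \<union> V3;
        x \<in> S (V1 \<union> {s1, s2}); y \<in> S V2; z \<in> S V3\<rbrakk>
      \<Longrightarrow> pcomp (V1 \<union> V2) V3 s2 (pcomp (insert s2 V1) V2 s1 x y) z
        = pcomp (V1 \<union> V3) V2 s1 (pcomp (insert s1 V1) V3 s2 x z) y"
    and pcomp_sequential:
      "\<lbrakk>finite V1; finite V2; finite V3; V1 \<inter> V2 = {}; V1 \<inter> V3 = {}; V2 \<inter> V3 = {};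
        s1 \<noteq> s2; s1 \<notin> V1 \<union> V2 \<union> V3; s2 \<notin> V1 \<union> V2 \<union> V3;
        x \<in> S (insert s1 V1); y \<in> S (insert s2 V2); z \<in> S V3\<rbrakk>
      \<Longrightarrow> pcomp (V1 \<union> V2) V3 s2 (pcomp V1 (insert s2 V2) s1 x y) z
        = pcomp V1 (V2 \<union> V3) s1 x (pcomp V2 V3 s2 y z)"
    and pcomp_unit_right:
      "\<lbrakk>composable V {v} s; x \<in> S (insert s V)\<rbrakk>
      \<Longrightarrow> pcomp V {v} s x (unit v) = act (insert s V) (id(s := v)) x"
    and pcomp_unit_left:
      "\<lbrakk>composable {} V s; x \<in> S V\<rbrakk> \<Longrightarrow> pcomp {} V s (unit s) x = x"

datatype end_label = Source | Target

type_synonym 'v or_edge = "('v \<times> end_label) uprod"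
type_synonym 'v or_multigraph = "'v or_edge multiset"

definition or_multigraphs :: "'v set \<Rightarrow> 'v or_multigraph set" where
  "or_multigraphs V = {g. \<forall>e \<in># g. set_uprod e \<subseteq> V \<times> UNIV}"

definition pointed_or_multigraphs :: "'v set \<Rightarrow> ('v or_multigraph \<times> 'v) set" where
  "pointed_or_multigraphs V = or_multigraphs V \<times> V"

text \<open>Free vector spaces are modelled by finitely supported functions \<open>'b \<Rightarrow>\<^sub>0 'k\<close>.\<close>

definition fscale :: "'k::field_char_0 \<Rightarrow> ('b \<Rightarrow>\<^sub>0 'k) \<Rightarrow> 'b \<Rightarrow>\<^sub>0 'k" where
  "fscale c x = Poly_Mapping.map ((*) c) x"

abbreviation basis_vec :: "'b \<Rightarrow> 'b \<Rightarrow>\<^sub>0 'k::field_char_0" where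
  "basis_vec b \<equiv> Poly_Mapping.single b 1"

definition lin_extend :: "('b \<Rightarrow> 'c \<Rightarrow>\<^sub>0 'k) \<Rightarrow> ('b \<Rightarrow>\<^sub>0 'k) \<Rightarrow> 'c \<Rightarrow>\<^sub>0 'k::field_char_0" where
  "lin_extend f x = (\<Sum>b \<in> Poly_Mapping.keys x. fscale (Poly_Mapping.lookup x b) (f b))"

definition bilin_extend ::
    "('a \<Rightarrow> 'b \<Rightarrow> 'c \<Rightarrow>\<^sub>0 'k) \<Rightarrow> ('a \<Rightarrow>\<^sub>0 'k) \<Rightarrow> ('b \<Rightarrow>\<^sub>0 'k) \<Rightarrow> 'c \<Rightarrow>\<^sub>0 'k::field_char_0" where
  "bilin_extend f x y = lin_extend (\<lambda>a. lin_extend (f a) y) x"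

text \<open>For \<open>V = {}\<close> the basis is empty, so \<open>MG {}\<close> is the zero space.\<close>

definition MG :: "'v set \<Rightarrow> ('v or_multigraph \<times> 'v \<Rightarrow>\<^sub>0 'k::field_char_0) set" where
  "MG V = {x. Poly_Mapping.keys x \<subseteq> pointed_or_multigraphs V}"

definition relabel :: "('v \<Rightarrow> 'v) \<Rightarrow> 'v or_multigraph \<times> 'v \<Rightarrow> 'v or_multigraph \<times> 'v" where
  "relabel \<sigma> = (\<lambda>(g, v). (image_mset (map_uprod (map_prod \<sigma> id)) g, \<sigma> v))"

definition MG_act :: "'v set \<Rightarrow> ('v \<Rightarrow> 'v) \<Rightarrow> ('v or_multigraph \<times> 'v \<Rightarrow>\<^sub>0 'k)
    \<Rightarrow> 'v or_multigraph \<times> 'v \<Rightarrow>\<^sub>0 'k::field_char_0" where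
  "MG_act V \<sigma> = lin_extend (\<lambda>b. basis_vec (relabel \<sigma> b))"

definition MG_unit :: "'v \<Rightarrow> 'v or_multigraph \<times> 'v \<Rightarrow>\<^sub>0 'k::field_char_0" where
  "MG_unit v = basis_vec ({#}, v)"

text \<open>
  The edges of a multigraph are distinguished by numbering the copies of each unordered pair.
  The two ends of an edge (also of a loop with equal labels, whose ends coincide as elements of
  \<open>V \<times> {s, t}\<close>) are distinguished by a boolean, after choosing an order of the pair;
  the result of the composition does not depend on that choice.
\<close>

type_synonym 'v edge_copy = "'v or_edge \<times> nat"
type_synonym 'v edge_end = "'v edge_copy \<times> bool"

definition edge_copies :: "'v or_multigraph \<Rightarrow> 'v edge_copy set" where
  "edge_copies g = {(e, i). i < count g e}"

definition ordered_ends :: "'v or_edge \<Rightarrow> ('v \<times> end_label) \<times> ('v \<times> end_label)" where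
  "ordered_ends e = (SOME p. Upair (fst p) (snd p) = e)"

definition end_at :: "'v edge_end \<Rightarrow> 'v \<times> end_label" where
  "end_at = (\<lambda>((e, i), b). if b then snd (ordered_ends e) else fst (ordered_ends e))"

definition loose_targets :: "'v \<Rightarrow> 'v or_multigraph \<Rightarrow> 'v edge_end set" where
  "loose_targets s g = {h \<in> edge_copies g \<times> UNIV. end_at h = (s, Target)}"

text \<open>\<open>v2\<close> receives the loose source ends, and \<open>\<phi>\<close> says where each loose target end goes.\<close>

definition reconnect_end ::
    "'v \<Rightarrow> 'v \<Rightarrow> ('v edge_end \<Rightarrow> 'v) \<Rightarrow> 'v edge_end \<Rightarrow> 'v \<times> end_label" where
  "reconnect_end s v2 \<phi> h =
    (if end_at h = (s, Source) then (v2, Source)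
     else if end_at h = (s, Target) then (\<phi> h, Target)
     else end_at h)"

definition reconnect ::
    "'v \<Rightarrow> 'v \<Rightarrow> ('v edge_end \<Rightarrow> 'v) \<Rightarrow> 'v or_multigraph \<Rightarrow> 'v or_multigraph" where
  "reconnect s v2 \<phi> g =
    image_mset (\<lambda>a. Upair (reconnect_end s v2 \<phi> (a, False)) (reconnect_end s v2 \<phi> (a, True)))
      (mset_set (edge_copies g))"

text \<open>For composable graphs no end of \<open>g2\<close> is at \<open>s\<close>, so \<open>g2\<close> has no loose ends.\<close>

definition graph_pcomp :: "'v set \<Rightarrow> 'v \<Rightarrow> 'v or_multigraph \<times> 'v \<Rightarrow> 'v or_multigraph \<times> 'v
    \<Rightarrow> 'v or_multigraph \<times> 'v \<Rightarrow>\<^sub>0 'k::field_char_0" where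
  "graph_pcomp V2 s = (\<lambda>(g1, v1) (g2, v2).
    \<Sum>\<phi> \<in> loose_targets s g1 \<rightarrow>\<^sub>E V2.
      basis_vec (reconnect s v2 \<phi> g1 + g2, if v1 = s then v2 else v1))"

definition MG_pcomp :: "'v set \<Rightarrow> 'v set \<Rightarrow> 'v \<Rightarrow> ('v or_multigraph \<times> 'v \<Rightarrow>\<^sub>0 'k)
    \<Rightarrow> ('v or_multigraph \<times> 'v \<Rightarrow>\<^sub>0 'k) \<Rightarrow> 'v or_multigraph \<times> 'v \<Rightarrow>\<^sub>0 'k::field_char_0" where
  "MG_pcomp V1 V2 s = bilin_extend (graph_pcomp V2 s)"

end

theory Submission
  imports Defs
begin

text \<open>
  Multigraphs are the monomials of the polynomial ring whose variables are the possible edges, and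
  disjoint union is multiplication.  Summing over all reconnections of the loose ends is then
  an algebra homomorphism \<open>H\<^sub>R\<close>, which sends an edge with ends \<open>a\<close>, \<open>b\<close> to the sum of the edges
  \<open>a'b'\<close> over \<open>a' \<in> R a\<close>, \<open>b' \<in> R b\<close>, where \<open>R\<close> assigns to each end the multiset of its possible
  replacements.  Up to the roots, \<open>g\<^sub>1 \<circ>\<^sub>s g\<^sub>2 = H\<^sub>R g\<^sub>1 \<cdot> g\<^sub>2\<close>, and relabelling is an \<open>H\<^sub>R\<close> with
  singleton values.  Since \<open>H\<^sub>R\<^sub>' \<circ> H\<^sub>R\<close> is the substitution of the Kleisli composite of \<open>R\<close> and
  \<open>R'\<close>, and \<open>H\<^sub>R\<close> fixes graphs without an end at \<open>s\<close>, naturality and both associativity axioms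
  reduce to identities between replacement maps, checked on a single end.
\<close>

section \<open>Linear extension\<close>

lemma lookup_fscale [simp]:
  "Poly_Mapping.lookup (fscale c x) k = c * Poly_Mapping.lookup x k"
  by (simp add: fscale_def Poly_Mapping.map.rep_eq when_def)

lemma vector_space_fscale: "vector_space (fscale :: 'k::field_char_0 \<Rightarrow> ('b \<Rightarrow>\<^sub>0 'k) \<Rightarrow> _)"
  by unfold_locales (auto intro!: poly_mapping_eqI simp: lookup_add algebra_simps)

lemma keys_fscale: "Poly_Mapping.keys (fscale c x) \<subseteq> Poly_Mapping.keys x"
  by (auto simp: in_keys_iff)

text \<open>Coefficients vanish off the support, so several arguments can be summed over one index
  set even when cancellation makes the support of their sum smaller.\<close>

lemma lin_extend_superset:
  assumes "finite A" "Poly_Mapping.keys x \<subseteq> A"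
  shows "lin_extend f x = (\<Sum>b\<in>A. fscale (Poly_Mapping.lookup x b) (f b))"
  unfolding lin_extend_def
  using assms by (intro sum.mono_neutral_left) (auto simp: in_keys_iff intro!: poly_mapping_eqI)

lemma lin_extend_zero [simp]: "lin_extend f 0 = 0"
  by (simp add: lin_extend_def)

lemma lin_extend_single [simp]: "lin_extend f (Poly_Mapping.single b c) = fscale c (f b)"
  by (subst lin_extend_superset[where A = "{b}"]) auto

lemma fscale_one [simp]: "fscale 1 x = x"
  by (intro poly_mapping_eqI) simp

lemma lin_extend_add: "lin_extend f (x + y) = lin_extend f x + lin_extend f y"
proof -
  let ?A = "Poly_Mapping.keys x \<union> Poly_Mapping.keys y"
  have "Poly_Mapping.keys (x + y) \<subseteq> ?A" by (rule Poly_Mapping.keys_add)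
  then show ?thesis
    by (simp add: lin_extend_superset[where A = ?A] flip: sum.distrib)
      (intro sum.cong poly_mapping_eqI refl, simp add: lookup_add algebra_simps)
qed

lemma lin_extend_scale: "lin_extend f (fscale c x) = fscale c (lin_extend f x)"
  by (subst lin_extend_superset[OF _ keys_fscale])
    (auto intro!: poly_mapping_eqI simp: lin_extend_def lookup_sum sum_distrib_left mult.assoc)

lemma lin_extend_sum: "lin_extend f (sum g A) = (\<Sum>i\<in>A. lin_extend f (g i))"
  by (induction A rule: infinite_finite_induct) (simp_all add: lin_extend_add)

lemma lin_extend_sum_mset:
  "lin_extend f (\<Sum>i\<in>#M. g i) = (\<Sum>i\<in>#M. lin_extend f (g i))"
  by (induction M) (simp_all add: lin_extend_add)

lemma lin_extend_cong:
  assumes "\<And>b. b \<in> Poly_Mapping.keys x \<Longrightarrow> f b = g b"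
  shows "lin_extend f x = lin_extend g x"
  using assms by (simp add: lin_extend_def)

lemma lin_extend_compose:
  "lin_extend g (lin_extend f x) = lin_extend (\<lambda>b. lin_extend g (f b)) x"
  by (subst (2) lin_extend_def) (simp add: lin_extend_sum lin_extend_scale lin_extend_def[of _ x])

lemma lin_extend_fun_add:
  "lin_extend (\<lambda>b. f b + g b) x = lin_extend f x + lin_extend g x"
  by (auto intro!: poly_mapping_eqI simp: lin_extend_def lookup_sum lookup_add algebra_simps sum.distrib)

lemma lin_extend_fun_scale:
  "lin_extend (\<lambda>b. fscale c (f b)) x = fscale c (lin_extend f x)"
  by (auto intro!: poly_mapping_eqI simp: lin_extend_def lookup_sum sum_distrib_left algebra_simps)

text \<open>Two finite sums are exchanged; through this the second argument of
  \<open>bilin_extend\<close> can be handled like the first.\<close>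

lemma lin_extend_swap:
  "lin_extend (\<lambda>a. lin_extend (f a) y) x = lin_extend (\<lambda>b. lin_extend (\<lambda>a. f a b) x) y"
  unfolding lin_extend_def
  by (rule poly_mapping_eqI, simp add: lookup_sum sum_distrib_left, subst sum.swap)
    (simp add: mult.left_commute)

lemma lin_extend_basis_vec [simp]: "lin_extend basis_vec x = x"
  by (rule poly_mapping_eqI)
    (auto simp: lin_extend_def lookup_sum lookup_single when_def sum.delta in_keys_iff
      if_distrib[of "\<lambda>t. _ * t"] cong: if_cong)

lemma keys_lin_extend:
  "Poly_Mapping.keys (lin_extend f x) \<subseteq> (\<Union>b\<in>Poly_Mapping.keys x. Poly_Mapping.keys (f b))"
  unfolding lin_extend_def
  by (rule order_trans[OF Poly_Mapping.keys_sum]) (intro UN_mono subset_refl keys_fscale)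

lemma fscale_mult_left: "fscale c x * y = fscale c (x * y)"
  by (simp add: fscale_def mult_map_scale_conv_mult mult.assoc)

lemma fscale_mult_right:
  fixes x y :: "'b::comm_monoid_add \<Rightarrow>\<^sub>0 'k::field_char_0"
  shows "x * fscale c y = fscale c (x * y)"
  by (simp add: fscale_def mult_map_scale_conv_mult mult.left_commute)

lemma lin_extend_mult_left: "lin_extend (\<lambda>b. f b * q) x = lin_extend f x * q"
  by (simp add: lin_extend_def sum_distrib_right fscale_mult_left)

lemma lin_extend_mult_right:
  fixes q :: "'b::comm_monoid_add \<Rightarrow>\<^sub>0 'k::field_char_0"
  shows "lin_extend (\<lambda>b. q * f b) x = q * lin_extend f x"
  by (simp add: lin_extend_def sum_distrib_left fscale_mult_right)

text \<open>Indexed by a monoid, finitely supported functions form the monoid algebra, where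
  \<open>basis_vec a * basis_vec b = basis_vec (a + b)\<close>. Expanding both factors in monomials
  therefore spreads multiplicativity from monomials to all products.\<close>

lemma lin_extend_mult:
  fixes f :: "'b::comm_monoid_add \<Rightarrow> 'c::comm_monoid_add \<Rightarrow>\<^sub>0 'k::field_char_0"
  assumes "\<And>a b. f (a + b) = f a * f b"
  shows "lin_extend f (p * q) = lin_extend f p * lin_extend f q"
proof -
  have "p * q = lin_extend (\<lambda>a. lin_extend (\<lambda>b. basis_vec (a + b)) q) p"
  proof -
    have "p * q = lin_extend (\<lambda>a. basis_vec a * q) p" by (simp add: lin_extend_mult_left)
    also have "(\<lambda>a. basis_vec a * q) = (\<lambda>a. lin_extend (\<lambda>b. basis_vec a * basis_vec b) q)"
      by (simp add: lin_extend_mult_right)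
    finally show ?thesis by (simp add: mult_single)
  qed
  then show ?thesis
    by (simp add: lin_extend_compose assms lin_extend_mult_right lin_extend_mult_left)
qed


section \<open>Bilinear extension and nested compositions\<close>

lemma bilin_extend_basis_vec [simp]: "bilin_extend f (basis_vec a) (basis_vec b) = f a b"
  by (simp add: bilin_extend_def)

lemma bilin_extend_lin_left:
  "bilin_extend f (lin_extend g x) y = lin_extend (\<lambda>a. bilin_extend f (g a) y) x"
  by (simp add: bilin_extend_def lin_extend_compose)

lemma bilin_extend_lin_right:
  "bilin_extend f x (lin_extend g y) = lin_extend (\<lambda>b. bilin_extend f x (g b)) y"
  unfolding bilin_extend_def lin_extend_compose by (rule lin_extend_swap)

lemma bilin_extend_expand_right:
  "bilin_extend f x y = lin_extend (\<lambda>b. bilin_extend f x (basis_vec b)) y"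
  using bilin_extend_lin_right[of f x basis_vec y] by simp

text \<open>This and the next lemma bring both ways of nesting to one form, a triple sum over basis
  elements, where the associativity axioms can be compared term by term.\<close>

lemma bilin_extend_bilin_left:
  "bilin_extend f (bilin_extend g x y) z =
    lin_extend (\<lambda>a. lin_extend (\<lambda>b. lin_extend (\<lambda>c.
      bilin_extend f (g a b) (basis_vec c)) z) y) x"
  by (simp add: bilin_extend_def[of g] bilin_extend_lin_left flip: bilin_extend_expand_right)

lemma bilin_extend_bilin_right:
  "bilin_extend f x (bilin_extend g y z) =
    lin_extend (\<lambda>a. lin_extend (\<lambda>b. lin_extend (\<lambda>c.
      bilin_extend f (basis_vec a) (g b c)) z) y) x"
proof -
  have "bilin_extend f x (bilin_extend g y z) =
      lin_extend (\<lambda>a. bilin_extend f (basis_vec a) (bilin_extend g y z)) x"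
    using bilin_extend_lin_left[of f basis_vec x] by simp
  then show ?thesis by (simp add: bilin_extend_def[of g] bilin_extend_lin_right)
qed

section \<open>Substitution of edge ends\<close>

text \<open>The symmetry by which \<open>subst_edge\<close>, written on ordered pairs, descends to
  unordered pairs.\<close>

lemma sum_mset_Upair_swap:
  fixes A B :: "'a multiset" and f :: "'a uprod \<Rightarrow> 'c::comm_monoid_add"
  shows "(\<Sum>a'\<in>#A. \<Sum>b'\<in>#B. f (Upair a' b')) = (\<Sum>b'\<in>#B. \<Sum>a'\<in>#A. f (Upair b' a'))"
proof -
  have "f (Upair a b) = f (Upair b a)" for a b
    by (rule arg_cong[where f = f]) simp
  then show ?thesis by (subst sum_mset.swap) presburger
qed

text \<open>The monomial \<open>{#e#}\<close> is the variable of the edge \<open>e\<close>, so the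
  value is a linear form. \<open>R\<close> takes multisets as values so that Kleisli composition
  keeps multiplicities.\<close>

lift_definition subst_edge ::
    "('a \<Rightarrow> 'b multiset) \<Rightarrow> 'a uprod \<Rightarrow> 'b uprod multiset \<Rightarrow>\<^sub>0 'k::field_char_0"
  is "\<lambda>R (a, b). \<Sum>a'\<in>#R a. \<Sum>b'\<in>#R b. basis_vec {#Upair a' b'#}"
  by (auto intro: sum_mset_Upair_swap[of "\<lambda>e. basis_vec {#e#}"])

lemma subst_edge_Upair:
  "subst_edge R (Upair a b) = (\<Sum>a'\<in>#R a. \<Sum>b'\<in>#R b. basis_vec {#Upair a' b'#})"
  by (simp add: subst_edge.abs_eq Upair.abs_eq)

lemma subst_edge_cong:
  assumes "\<And>a. a \<in> set_uprod e \<Longrightarrow> R a = R' a"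
  shows "subst_edge R e = subst_edge R' e"
  using assms by (cases e) (simp add: subst_edge_Upair)

text \<open>The value of \<open>H\<^sub>R\<close> at a monomial; the homomorphism
  \<open>H\<^sub>R\<close> itself is \<open>lin_extend (subst_graph R)\<close>.\<close>

definition subst_graph ::
    "('a \<Rightarrow> 'b multiset) \<Rightarrow> 'a uprod multiset \<Rightarrow> 'b uprod multiset \<Rightarrow>\<^sub>0 'k::field_char_0" where
  "subst_graph R g = (\<Prod>e\<in>#g. subst_edge R e)"

lemma subst_graph_empty [simp]: "subst_graph R {#} = 1"
  by (simp add: subst_graph_def)

lemma subst_graph_add_mset [simp]:
  "subst_graph R (add_mset e g) = subst_edge R e * subst_graph R g"
  by (simp add: subst_graph_def)

lemma subst_graph_union: "subst_graph R (g + h) = subst_graph R g * subst_graph R h"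
  by (simp add: subst_graph_def)

text \<open>Every sum has a single summand, so a graph goes to a graph. Relabelling and the identity
  are of this kind.\<close>

lemma subst_graph_singleton:
  "subst_graph (\<lambda>a. {#f a#}) g = basis_vec (image_mset (map_uprod f) g)"
proof (induction g)
  case (add e g)
  then show ?case by (cases e) (simp add: subst_edge_Upair mult_single)
qed simp

lemma subst_graph_image_mset:
  "subst_graph R (image_mset (map_uprod f) g) = subst_graph (\<lambda>a. R (f a)) g"
proof (induction g)
  case (add e g)
  then show ?case by (cases e) (simp add: subst_edge_Upair)
qed simp

lemma sum_mset_image_sum_mset:
  "(\<Sum>c\<in>#(\<Sum>b\<in>#M. R b). f c) = (\<Sum>b\<in>#M. \<Sum>c\<in>#R b. f c)"
  by (induction M) simp_all

lemma lin_extend_subst_edge: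
  "lin_extend (subst_graph R') (subst_edge R e) = subst_edge (\<lambda>a. \<Sum>b\<in>#R a. R' b) e"
proof (cases e)
  case (Upair a b)
  \<comment> \<open>Fully expanded, the two sides differ in the order of the middle sums: one over
    \<open>R b\<close>, the other over the second replacements of the end \<open>a\<close>.\<close>
  then show ?thesis
    by (simp add: subst_edge_Upair lin_extend_sum_mset sum_mset_image_sum_mset)
      (subst (2) sum_mset.swap, rule refl)
qed

lemma lin_extend_subst_graph_mult:
  "lin_extend (subst_graph R) (p * q) = lin_extend (subst_graph R) p * lin_extend (subst_graph R) q"
  by (rule lin_extend_mult) (rule subst_graph_union)

text \<open>The Kleisli law: both sides are multiplicative in \<open>g\<close>, so the case of one
  edge suffices.\<close>

lemma lin_extend_subst_graph:
  "lin_extend (subst_graph R') (subst_graph R g) = subst_graph (\<lambda>a. \<Sum>b\<in>#R a. R' b) g"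
  by (induction g)
    (simp_all add: lin_extend_subst_graph_mult lin_extend_subst_edge flip: single_one)

text \<open>For naturality and sequential composition the replacement maps are compared only at
  vertices that the graph can have.\<close>

lemma subst_graph_cong:
  assumes "g \<in> or_multigraphs V" "\<And>v l. v \<in> V \<Longrightarrow> R (v, l) = R' (v, l)"
  shows "subst_graph R g = subst_graph R' g"
proof -
  have "subst_edge R e = subst_edge R' e" if "e \<in># g" for e
    using that assms by (intro subst_edge_cong) (auto simp: or_multigraphs_def)
  then show ?thesis unfolding subst_graph_def by (metis image_mset_cong)
qed

section \<open>The partial composition as a substitution\<close>

text \<open>The root of a composite is the same for all choices, so it can be kept apart from the
  polynomial of graphs, which alone is multiplied and substituted.\<close>

definition point_at :: "'v \<Rightarrow> ('g \<Rightarrow>\<^sub>0 'k) \<Rightarrow> 'g \<times> 'v \<Rightarrow>\<^sub>0 'k::field_char_0" where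
  "point_at v = lin_extend (\<lambda>g. basis_vec (g, v))"

text \<open>The replacement map \<open>R\<close> for inserting, at \<open>s\<close>, a graph with
  vertex set \<open>V\<close> and root \<open>v\<close>.\<close>

definition end_choices :: "'v \<Rightarrow> 'v set \<Rightarrow> 'v \<Rightarrow> 'v \<times> end_label \<Rightarrow> ('v \<times> end_label) multiset" where
  "end_choices s V v a =
    (if a = (s, Source) then {#(v, Source)#}
     else if a = (s, Target) then image_mset (\<lambda>w. (w, Target)) (mset_set V)
     else {#a#})"

lemma end_choices_simps [simp]:
  "end_choices s V v (s, Source) = {#(v, Source)#}"
  "end_choices s V v (s, Target) = image_mset (\<lambda>w. (w, Target)) (mset_set V)"
  by (simp_all add: end_choices_def)

lemma end_choices_other: "u \<noteq> s \<Longrightarrow> end_choices s V v (u, l) = {#(u, l)#}"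
  by (simp add: end_choices_def)

text \<open>Ends that already lie in \<open>W\<close> stay put under a later insertion at a point
  outside \<open>W\<close>.\<close>

lemma bind_end_choices:
  assumes "finite W" "s \<notin> W"
  shows "(\<Sum>a\<in>#image_mset (\<lambda>u. (u, l)) (mset_set W). end_choices s V v a)
    = image_mset (\<lambda>u. (u, l)) (mset_set W)"
  using assms by (induction W rule: finite_induct) (auto simp: end_choices_other)

section \<open>Numbered edges and sums over reconnections\<close>

lemma edge_copies_eq: "edge_copies g = Sigma (set_mset g) (\<lambda>e. {..<count g e})"
  by (auto simp: edge_copies_def intro: count_inI)

lemma finite_edge_copies [simp]: "finite (edge_copies g)"
  by (simp add: edge_copies_eq)

lemma image_mset_fst_edge_copies: "image_mset fst (mset_set (edge_copies g)) = g"
proof (rule multiset_eqI)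
  fix e
  have "count (image_mset fst (mset_set (edge_copies g))) e
      = (\<Sum>a\<in>fst -` {e} \<inter> edge_copies g. count (mset_set (edge_copies g)) a)"
    by (simp add: count_image_mset)
  also have "\<dots> = card (fst -` {e} \<inter> edge_copies g)"
    by simp
  also have "fst -` {e} \<inter> edge_copies g = Pair e ` {..<count g e}"
    by (auto simp: edge_copies_def)
  finally show "count (image_mset fst (mset_set (edge_copies g))) e = count g e"
    by (simp add: card_image inj_on_def)
qed

lemma prod_edge_copies: "(\<Prod>a\<in>edge_copies g. f (fst a)) = (\<Prod>e\<in>#g. f e)"
proof -
  have "(\<Prod>e\<in>#g. f e) = (\<Prod>e\<in>#image_mset fst (mset_set (edge_copies g)). f e)"
    by (simp only: image_mset_fst_edge_copies)
  also have "\<dots> = (\<Prod>a\<in>edge_copies g. f (fst a))"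
    by (simp add: prod_unfold_prod_mset multiset.map_comp comp_def)
  finally show ?thesis ..
qed

text \<open>The only fact about the chosen order that enters the proof, so the choice cannot affect
  the result.\<close>

lemma Upair_ordered_ends: "Upair (fst (ordered_ends e)) (snd (ordered_ends e)) = e"
  unfolding ordered_ends_def by (rule someI_ex) (metis fst_conv snd_conv uprod_exhaust)

lemma Upair_end_at: "Upair (end_at (a, False)) (end_at (a, True)) = fst a"
  by (cases a) (simp add: end_at_def Upair_ordered_ends)

lemma prod_basis_vec:
  "finite A \<Longrightarrow> (\<Prod>a\<in>A. basis_vec {#f a#}) = basis_vec (image_mset f (mset_set A))"
  by (induction A rule: finite_induct) (simp_all add: mult_single)

text \<open>A function on the ends amounts to a pair of values for each edge; after this change of
  index the claim is the distributive law \<open>prod_sum_PiE\<close>.\<close>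

lemma sum_PiE_pairs:
  fixes C :: "'e \<times> bool \<Rightarrow> 'w set"
  assumes "finite A" "\<And>h. finite (C h)"
  shows "(\<Sum>\<phi>\<in>PiE (A \<times> UNIV) C. \<Prod>a\<in>A. f a (\<phi> (a, False)) (\<phi> (a, True)))
    = (\<Prod>a\<in>A. \<Sum>x\<in>C (a, False). \<Sum>y\<in>C (a, True). (f a x y :: 'r::comm_semiring_1))"
proof -
  let ?B = "\<lambda>a. C (a, False) \<times> C (a, True)"
  \<comment> \<open>Both maps are restricted to their domains because members of \<open>PiE\<close>
    are \<open>undefined\<close> elsewhere; only so are they mutually inverse.\<close>
  let ?i = "\<lambda>\<phi>. \<lambda>a\<in>A. (\<phi> (a, False), \<phi> (a, True))"
  let ?j = "\<lambda>\<psi>. \<lambda>(a, b)\<in>A \<times> UNIV. if b then snd (\<psi> a) else fst (\<psi> a)"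
  have "(\<Sum>\<phi>\<in>PiE (A \<times> UNIV) C. \<Prod>a\<in>A. f a (\<phi> (a, False)) (\<phi> (a, True)))
      = (\<Sum>\<psi>\<in>PiE A ?B. \<Prod>a\<in>A. f a (fst (\<psi> a)) (snd (\<psi> a)))"
  proof (rule sum.reindex_bij_witness[where i = ?j and j = ?i])
    fix \<phi> assume \<phi>: "\<phi> \<in> PiE (A \<times> UNIV) C"
    then show "?i \<phi> \<in> PiE A ?B" by fastforce
    show "?j (?i \<phi>) = \<phi>"
      using \<phi> by (intro ext) (auto simp: PiE_def extensional_def restrict_def)
  next
    fix \<psi> assume \<psi>: "\<psi> \<in> PiE A ?B"
    then have "fst (\<psi> a) \<in> C (a, False)" "snd (\<psi> a) \<in> C (a, True)" if "a \<in> A" for a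
      using PiE_mem[OF \<psi> that] by auto
    then show "?j \<psi> \<in> PiE (A \<times> UNIV) C" by auto
    show "?i (?j \<psi>) = \<psi>"
      using \<psi> by (intro ext) (auto simp: PiE_def extensional_def restrict_def)
  qed simp
  also have "\<dots> = (\<Prod>a\<in>A. \<Sum>p\<in>?B a. f a (fst p) (snd p))"
    using assms by (subst prod_sum_PiE) auto
  finally show ?thesis by (simp add: sum.cartesian_product case_prod_beta)
qed

text \<open>The bridge from the definition by numbered edges to the polynomial picture, in which the
  identities between compositions are then proved.\<close>

lemma sum_reconnect:
  assumes "finite V"
  shows "(\<Sum>\<phi>\<in>loose_targets s g \<rightarrow>\<^sub>E V. basis_vec (reconnect s v \<phi> g) :: _ \<Rightarrow>\<^sub>0 'k::field_char_0)
    = subst_graph (end_choices s V v) g"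
proof -
  \<comment> \<open>Functions in \<open>loose_targets s g \<rightarrow>\<^sub>E V\<close> are \<open>undefined\<close> elsewhere, so they range over a product
    indexed by all edge ends, which factors over the edges.\<close>
  define C where "C h = (if end_at h = (s, Target) then V else {undefined})" for h
  \<comment> \<open>A reconnected end depends on \<open>\<phi>\<close> only through the value at
    that very end, which is what separates the factors.\<close>
  define re where "re h x = reconnect_end s v (\<lambda>_. x) h" for h x
  have [simp]: "reconnect_end s v \<phi> h = re h (\<phi> h)" for \<phi> h
    by (simp add: re_def reconnect_end_def)
  have fin: "finite (C h)" for h
    using assms by (simp add: C_def)
  have "(loose_targets s g \<rightarrow>\<^sub>E V) = PiE (edge_copies g \<times> UNIV) C"
    by (auto simp: PiE_def Pi_def extensional_def loose_targets_def C_def split: if_splits) metis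
  then have "(\<Sum>\<phi>\<in>loose_targets s g \<rightarrow>\<^sub>E V. basis_vec (reconnect s v \<phi> g) :: _ \<Rightarrow>\<^sub>0 'k)
      = (\<Sum>\<phi>\<in>PiE (edge_copies g \<times> UNIV) C. \<Prod>a\<in>edge_copies g.
          basis_vec {#Upair (re (a, False) (\<phi> (a, False))) (re (a, True) (\<phi> (a, True)))#})"
    by (simp add: reconnect_def prod_basis_vec)
  also have "\<dots> = (\<Prod>a\<in>edge_copies g. \<Sum>x\<in>C (a, False). \<Sum>y\<in>C (a, True).
      basis_vec {#Upair (re (a, False) x) (re (a, True) y)#})"
    by (rule sum_PiE_pairs) (simp_all add: fin)
  also have "\<dots> = (\<Prod>a\<in>edge_copies g. subst_edge (end_choices s V v) (fst a))"
  proof (rule prod.cong)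
    fix a
    \<comment> \<open>At a loose target both sums run over \<open>V\<close>; at any other end
      \<open>C h\<close> has one element, whose value \<open>re\<close> ignores.\<close>
    have choices: "(\<Sum>x\<in>C h. F (re h x)) = (\<Sum>b\<in>#end_choices s V v (end_at h). F b)"
      for h and F :: "_ \<Rightarrow> _ \<Rightarrow>\<^sub>0 'k"
      by (simp add: C_def re_def reconnect_end_def end_choices_def sum_unfold_sum_mset
          multiset.map_comp comp_def)
    have "(\<Sum>x\<in>C (a, False). \<Sum>y\<in>C (a, True).
          basis_vec {#Upair (re (a, False) x) (re (a, True) y)#} :: _ \<Rightarrow>\<^sub>0 'k)
        = (\<Sum>x\<in>C (a, False). \<Sum>c\<in>#end_choices s V v (end_at (a, True)).
          basis_vec {#Upair (re (a, False) x) c#})"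
      by (intro sum.cong refl choices)
    also have "\<dots> = subst_edge (end_choices s V v) (Upair (end_at (a, False)) (end_at (a, True)))"
      unfolding subst_edge_Upair
      by (rule choices)
    finally show "(\<Sum>x\<in>C (a, False). \<Sum>y\<in>C (a, True).
          basis_vec {#Upair (re (a, False) x) (re (a, True) y)#} :: _ \<Rightarrow>\<^sub>0 'k)
        = subst_edge (end_choices s V v) (fst a)"
      by (simp add: Upair_end_at)
  qed simp
  finally show ?thesis by (simp add: prod_edge_copies subst_graph_def)
qed

lemma graph_pcomp_eq:
  assumes "finite V"
  shows "graph_pcomp V s (g, v) (h, w) = point_at (if v = s then w else v)
    (subst_graph (end_choices s V w) g * basis_vec h)"
  by (simp add: graph_pcomp_def point_at_def sum_distrib_right mult_single lin_extend_sum
      flip: sum_reconnect[OF assms])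


lemma point_at_basis_vec [simp]: "point_at v (basis_vec g) = basis_vec (g, v)"
  by (simp add: point_at_def)

text \<open>A composite is again of the form \<open>point_at v p\<close>. As a left argument its
  polynomial is substituted into, as a right argument (next lemma) it is a mere factor.\<close>

lemma graph_pcomp_point_at_left:
  assumes "finite V"
  shows "bilin_extend (graph_pcomp V s) (point_at v p) (basis_vec (h, w))
    = point_at (if v = s then w else v)
        (lin_extend (subst_graph (end_choices s V w)) p * basis_vec h)"
  unfolding point_at_def
  by (simp add: bilin_extend_lin_left graph_pcomp_eq[OF assms] point_at_def lin_extend_compose
      flip: lin_extend_mult_left)

lemma graph_pcomp_point_at_right:
  assumes "finite V"
  shows "bilin_extend (graph_pcomp V s) (basis_vec (g, v)) (point_at w p)
    = point_at (if v = s then w else v) (subst_graph (end_choices s V w) g * p)"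
proof -
  let ?q = "subst_graph (end_choices s V w) g"
  have "?q * p = lin_extend (\<lambda>h. ?q * basis_vec h) p"
    by (simp add: lin_extend_mult_right)
  then show ?thesis
    by (simp add: bilin_extend_lin_right graph_pcomp_eq[OF assms] point_at_def lin_extend_compose)
qed

lemma MG_act_point_at:
  "MG_act V \<sigma> (point_at v p)
    = point_at (\<sigma> v) (lin_extend (subst_graph (\<lambda>a. {#map_prod \<sigma> id a#})) p)"
  by (simp add: MG_act_def point_at_def lin_extend_compose relabel_def subst_graph_singleton)

text \<open>Each end is its own sole replacement. In parallel composition this keeps either inserted
  graph fixed under the other insertion.\<close>

lemma subst_graph_no_ends:
  assumes "g \<in> or_multigraphs V" "s \<notin> V"
  shows "subst_graph (end_choices s W w) g = basis_vec g"
proof -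
  have "subst_graph (end_choices s W w) g = subst_graph (\<lambda>a. {#id a#}) g"
    using assms by (intro subst_graph_cong) (auto simp: end_choices_def)
  then show ?thesis by (simp add: subst_graph_singleton uprod.map_id0[unfolded id_def])
qed

section \<open>Relabelling of basis elements\<close>

lemma relabel_cong:
  assumes "b \<in> pointed_or_multigraphs V" "\<And>v. v \<in> V \<Longrightarrow> \<sigma> v = \<tau> v"
  shows "relabel \<sigma> b = relabel \<tau> b"
  using assms
  by (auto simp: relabel_def pointed_or_multigraphs_def or_multigraphs_def
      intro!: image_mset_cong uprod.map_cong0) (metis mem_Sigma_iff subsetD)

lemma relabel_id [simp]: "relabel id = id"
  by (simp add: relabel_def prod.map_id0 uprod.map_id0 fun_eq_iff)

lemma relabel_comp: "relabel (\<tau> \<circ> \<sigma>) = relabel \<tau> \<circ> relabel \<sigma>"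
  by (auto simp: relabel_def fun_eq_iff multiset.map_comp uprod.map_comp prod.map_comp comp_def
      id_def)

lemma relabel_closed:
  assumes "b \<in> pointed_or_multigraphs V" "\<sigma> ` V \<subseteq> W"
  shows "relabel \<sigma> b \<in> pointed_or_multigraphs W"
  using assms
  by (fastforce simp: relabel_def pointed_or_multigraphs_def or_multigraphs_def uprod.set_map)

section \<open>The operad axioms on basis elements\<close>

lemma graph_pcomp_closed:
  assumes "a \<in> pointed_or_multigraphs (insert s V1)" "b \<in> pointed_or_multigraphs V2"
  shows "Poly_Mapping.keys (graph_pcomp V2 s a b) \<subseteq> pointed_or_multigraphs (V1 \<union> V2)"
proof -
  obtain g v h w where ab: "a = (g, v)" "b = (h, w)" by (metis surj_pair)
  have "reconnect s w \<phi> g + h \<in> or_multigraphs (V1 \<union> V2)"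
    if \<phi>: "\<phi> \<in> loose_targets s g \<rightarrow>\<^sub>E V2" for \<phi>
  proof -
    \<comment> \<open>A reconnected end is at \<open>w\<close>, at a value of \<open>\<phi>\<close>
      in \<open>V2\<close>, or unmoved and then at a vertex of \<open>V1\<close>.\<close>
    have ends: "reconnect_end s w \<phi> (c, d) \<in> (V1 \<union> V2) \<times> UNIV" if c: "c \<in> edge_copies g" for c d
    proof -
      have "fst c \<in># g" using c by (auto simp: edge_copies_eq)
      then have "set_uprod (fst c) \<subseteq> insert s V1 \<times> UNIV"
        using assms ab by (auto simp: pointed_or_multigraphs_def or_multigraphs_def)
      then have "end_at (c, d) \<in> insert s V1 \<times> UNIV"
        by (cases d) (simp_all flip: Upair_end_at)
      moreover have "\<phi> (c, d) \<in> V2" if "end_at (c, d) = (s, Target)"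
        using that c by (intro PiE_mem[OF \<phi>]) (simp add: loose_targets_def)
      moreover have "w \<in> V2" using assms ab by (simp add: pointed_or_multigraphs_def)
      ultimately show ?thesis
        by (cases "end_at (c, d)"; cases "snd (end_at (c, d))") (auto simp: reconnect_end_def)
    qed
    have "set_uprod e \<subseteq> (V1 \<union> V2) \<times> UNIV" if e_in: "e \<in># reconnect s w \<phi> g" for e
    proof -
      obtain c where c: "c \<in> edge_copies g"
        and e: "e = Upair (reconnect_end s w \<phi> (c, False)) (reconnect_end s w \<phi> (c, True))"
        using e_in by (auto simp: reconnect_def)
      show ?thesis using ends[OF c, of False] ends[OF c, of True] by (simp only: e set_uprod_simps) blast
    qed
    then show ?thesis
      using assms ab by (fastforce simp: or_multigraphs_def pointed_or_multigraphs_def)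
  qed
  moreover have "(if v = s then w else v) \<in> V1 \<union> V2"
    using assms ab by (auto simp: pointed_or_multigraphs_def)
  ultimately show ?thesis
    unfolding ab graph_pcomp_def prod.case
    by (intro order_trans[OF Poly_Mapping.keys_sum] UN_least)
      (simp add: pointed_or_multigraphs_def)
qed

lemma graph_pcomp_natural:
  assumes "composable V1 V2 s" "composable W1 W2 s'"
    and "bij_betw \<sigma> V1 W1" "\<sigma> s = s'" "bij_betw \<tau> V2 W2"
    and a: "a \<in> pointed_or_multigraphs (insert s V1)" and b: "b \<in> pointed_or_multigraphs V2"
  shows "MG_act (V1 \<union> V2) (\<lambda>v. if v \<in> V1 then \<sigma> v else \<tau> v) (graph_pcomp V2 s a b :: _ \<Rightarrow>\<^sub>0 'k::field_char_0)
    = graph_pcomp W2 s' (relabel \<sigma> a) (relabel \<tau> b)"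
proof -
  obtain g v h w where ab: "a = (g, v)" "b = (h, w)" by (metis surj_pair)
  define \<rho> where "\<rho> = (\<lambda>v. if v \<in> V1 then \<sigma> v else \<tau> v)"
  let ?\<rho> = "\<lambda>a. {#map_prod \<rho> (id :: end_label \<Rightarrow> _) a#}"
  have fin: "finite V2" "finite W2" and s: "s \<notin> V1" "s \<notin> V2" "s' \<notin> W1" "V1 \<inter> V2 = {}"
    using assms by (auto simp: composable_def)
  have \<rho>1: "\<rho> u = \<sigma> u" "\<sigma> u \<noteq> s'" if "u \<in> V1" for u
    using that s assms(3) by (auto simp: \<rho>_def bij_betw_def)
  have \<rho>2: "\<rho> u = \<tau> u" if "u \<in> V2" for u
    using that s by (auto simp: \<rho>_def)
  have g: "g \<in> or_multigraphs (insert s V1)" "v \<in> insert s V1" "w \<in> V2"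
    using a b by (auto simp: ab pointed_or_multigraphs_def)
  \<comment> \<open>\<open>\<sigma>\<close> maps \<open>V1\<close> into \<open>W1\<close>, which
    misses \<open>s'\<close>, so the root is replaced after relabelling exactly when it was
    before.\<close>
  have root: "\<rho> (if v = s then w else v) = (if \<sigma> v = s' then \<tau> w else \<sigma> v)"
    using g \<rho>1 \<rho>2 assms(4) by auto
  have "image_mset \<rho> (mset_set V2) = image_mset \<tau> (mset_set V2)"
    using fin \<rho>2 by (intro image_mset_cong) simp
  also have "\<dots> = mset_set W2"
    using assms(5) by (simp add: bij_betw_def image_mset_mset_set)
  finally have "image_mset \<rho> (mset_set V2) = mset_set W2" .
  then have targets: "image_mset (\<lambda>u. (\<rho> u, l)) (mset_set V2) = image_mset (\<lambda>u. (u, l)) (mset_set W2)"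
    for l :: end_label
    by (simp add: multiset.map_comp comp_def flip: \<open>image_mset \<rho> (mset_set V2) = mset_set W2\<close>)
  \<comment> \<open>On the left an end is replaced and then relabelled, on the right it is
    relabelled and then replaced.\<close>
  have "subst_graph (\<lambda>a. \<Sum>b\<in>#end_choices s V2 w a. ?\<rho> b) g
      = (subst_graph (\<lambda>a. end_choices s' W2 (\<tau> w) (map_prod \<sigma> id a)) g :: _ \<Rightarrow>\<^sub>0 'k)"
  proof (rule subst_graph_cong[OF g(1)])
    fix u l assume "u \<in> insert s V1"
    then consider "u = s" | "u \<in> V1" "u \<noteq> s" by blast
    then show "(\<Sum>b\<in>#end_choices s V2 w (u, l). ?\<rho> b)
        = end_choices s' W2 (\<tau> w) (map_prod \<sigma> id (u, l))"
    proof cases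
      case 1
      then show ?thesis
        using g(3) assms(4) by (cases l) (simp_all add: \<rho>2 targets multiset.map_comp comp_def)
    next
      case 2
      then show ?thesis by (simp add: end_choices_other \<rho>1)
    qed
  qed
  moreover have "relabel \<rho> b = relabel \<tau> b"
    using b \<rho>2 by (rule relabel_cong)
  ultimately show ?thesis
    unfolding ab graph_pcomp_eq[OF fin(1)] \<rho>_def[symmetric] MG_act_point_at
    by (simp add: relabel_def ab graph_pcomp_eq[OF fin(2)] root lin_extend_subst_graph_mult
        lin_extend_subst_graph subst_graph_image_mset subst_graph_singleton)
qed

text \<open>The two substitutions commute because neither creates an end at the point of the other,
  and the inserted graphs have no end at either point.\<close>

lemma graph_pcomp_parallel:
  assumes "finite V2" "finite V3" "s1 \<noteq> s2" "s1 \<notin> V2 \<union> V3" "s2 \<notin> V2 \<union> V3"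
    and b: "b \<in> pointed_or_multigraphs V2" and c: "c \<in> pointed_or_multigraphs V3"
  shows "bilin_extend (graph_pcomp V3 s2) (graph_pcomp V2 s1 a b) (basis_vec c)
    = bilin_extend (graph_pcomp V2 s1) (graph_pcomp V3 s2 a c) (basis_vec b)"
proof -
  obtain g1 v1 g2 v2 g3 v3 where abc: "a = (g1, v1)" "b = (g2, v2)" "c = (g3, v3)"
    by (metis surj_pair)
  have g: "g2 \<in> or_multigraphs V2" "v2 \<in> V2" "g3 \<in> or_multigraphs V3" "v3 \<in> V3"
    using b c by (auto simp: abc pointed_or_multigraphs_def)
  have "(\<lambda>a. \<Sum>b\<in>#end_choices s1 V2 v2 a. end_choices s2 V3 v3 b)
      = (\<lambda>a. \<Sum>b\<in>#end_choices s2 V3 v3 a. end_choices s1 V2 v2 b)"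
  proof
    fix a :: "'a \<times> end_label"
    obtain u l where a: "a = (u, l)" by fastforce
    have "v2 \<noteq> s2" "v3 \<noteq> s1" using assms g by auto
    then show "(\<Sum>b\<in>#end_choices s1 V2 v2 a. end_choices s2 V3 v3 b)
      = (\<Sum>b\<in>#end_choices s2 V3 v3 a. end_choices s1 V2 v2 b)"
      using assms unfolding a
      by (cases "u = s1"; cases "u = s2"; cases l) (auto simp: end_choices_other bind_end_choices)
  qed
  then show ?thesis
    using assms g
    by (auto simp: abc graph_pcomp_eq graph_pcomp_point_at_left lin_extend_subst_graph_mult
        lin_extend_subst_graph subst_graph_no_ends[of g2 V2] subst_graph_no_ends[of g3 V3] mult_ac)
qed

text \<open>An end at \<open>s1\<close> first moves into \<open>insert s2 V2\<close> and, if it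
  lands on \<open>s2\<close>, moves on into \<open>V3\<close>; the composite is one insertion over
  \<open>V2 \<union> V3\<close>. The factors from \<open>g2\<close> and \<open>g3\<close> are the
  same on both sides.\<close>

lemma graph_pcomp_sequential:
  assumes "finite V2" "finite V3" "V2 \<inter> V3 = {}" "s1 \<noteq> s2" "s1 \<notin> V1 \<union> V2 \<union> V3"
      "s2 \<notin> V1 \<union> V2 \<union> V3"
    and a: "a \<in> pointed_or_multigraphs (insert s1 V1)"
    and b: "b \<in> pointed_or_multigraphs (insert s2 V2)" and c: "c \<in> pointed_or_multigraphs V3"
  shows "bilin_extend (graph_pcomp V3 s2) (graph_pcomp (insert s2 V2) s1 a b) (basis_vec c :: _ \<Rightarrow>\<^sub>0 'k::field_char_0)
    = bilin_extend (graph_pcomp (V2 \<union> V3) s1) (basis_vec a) (graph_pcomp V3 s2 b c)"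
proof -
  obtain g1 v1 g2 v2 g3 v3 where abc: "a = (g1, v1)" "b = (g2, v2)" "c = (g3, v3)"
    by (metis surj_pair)
  \<comment> \<open>The root of the composite of \<open>b\<close> and \<open>c\<close>, hence the
    final place of a loose source end.\<close>
  let ?r = "if v2 = s2 then v3 else v2"
  have g: "g1 \<in> or_multigraphs (insert s1 V1)" "v1 \<in> insert s1 V1"
    using a by (auto simp: abc pointed_or_multigraphs_def)
  have "subst_graph (\<lambda>a. \<Sum>b\<in>#end_choices s1 (insert s2 V2) v2 a. end_choices s2 V3 v3 b) g1
      = (subst_graph (end_choices s1 (V2 \<union> V3) ?r) g1 :: _ \<Rightarrow>\<^sub>0 'k)"
  proof (rule subst_graph_cong[OF g(1)])
    fix v l assume v: "v \<in> insert s1 V1"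
    \<comment> \<open>By disjointness a loose target reaches each vertex exactly once: those of
      \<open>V2\<close> directly, those of \<open>V3\<close> by way of \<open>s2\<close>.\<close>
    have "mset_set (V2 \<union> V3) = mset_set V2 + mset_set V3"
      using assms by (simp add: mset_set_Union)
    then show "(\<Sum>b\<in>#end_choices s1 (insert s2 V2) v2 (v, l). end_choices s2 V3 v3 b)
        = end_choices s1 (V2 \<union> V3) ?r (v, l)"
      using v assms
      by (cases "v = s1"; cases "v = s2"; cases l) (auto simp: end_choices_other bind_end_choices)
  qed
  then show ?thesis
    using assms g
    by (auto simp: abc graph_pcomp_eq graph_pcomp_point_at_left graph_pcomp_point_at_right
        lin_extend_subst_graph_mult lin_extend_subst_graph mult_ac)
qed

section \<open>The operad\<close>

lemma MG_lin_extend: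
  assumes "x \<in> MG V"
    and "\<And>b. b \<in> pointed_or_multigraphs V \<Longrightarrow> Poly_Mapping.keys (f b) \<subseteq> pointed_or_multigraphs W"
  shows "lin_extend f x \<in> MG W"
  using assms unfolding MG_def mem_Collect_eq
  by (intro order_trans[OF keys_lin_extend UN_least]) auto

text \<open>Membership in \<open>MG V\<close> enters here: identities need checking only on basis
  elements over \<open>V\<close>.\<close>

lemma MG_lin_extend_cong:
  assumes "x \<in> MG V" "\<And>b. b \<in> pointed_or_multigraphs V \<Longrightarrow> f b = g b"
  shows "lin_extend f x = lin_extend g x"
  using assms by (intro lin_extend_cong) (auto simp: MG_def)

lemma bilin_extend_add_left:
  "bilin_extend f (x + x') y = bilin_extend f x y + bilin_extend f x' y"
  by (simp add: bilin_extend_def lin_extend_add)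

lemma bilin_extend_scale_left: "bilin_extend f (fscale c x) y = fscale c (bilin_extend f x y)"
  by (simp add: bilin_extend_def lin_extend_scale)

lemma bilin_extend_add_right:
  "bilin_extend f x (y + y') = bilin_extend f x y + bilin_extend f x y'"
  by (simp add: bilin_extend_def lin_extend_add lin_extend_fun_add)

lemma bilin_extend_scale_right: "bilin_extend f x (fscale c y) = fscale c (bilin_extend f x y)"
  by (simp add: bilin_extend_def lin_extend_scale lin_extend_fun_scale)

lemma species_MG:
  "species (fscale :: 'k::field_char_0 \<Rightarrow> ('v or_multigraph \<times> 'v \<Rightarrow>\<^sub>0 'k) \<Rightarrow> _) MG MG_act"
proof (intro species.intro vector_space_fscale species_axioms.intro)
  interpret vector_space "fscale :: 'k \<Rightarrow> ('v or_multigraph \<times> 'v \<Rightarrow>\<^sub>0 'k) \<Rightarrow> _"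
    by (rule vector_space_fscale)
  fix V W :: "'v set" and \<sigma> \<tau> :: "'v \<Rightarrow> 'v" and c :: 'k
    and x y :: "'v or_multigraph \<times> 'v \<Rightarrow>\<^sub>0 'k"
  show "subspace (MG V)"
    by (rule subspaceI)
      (auto simp: MG_def dest!: subsetD[OF Poly_Mapping.keys_add] subsetD[OF keys_fscale])
  show "MG_act V \<sigma> (x + y) = MG_act V \<sigma> x + MG_act V \<sigma> y"
    by (simp add: MG_act_def lin_extend_add)
  show "MG_act V \<sigma> (fscale c x) = fscale c (MG_act V \<sigma> x)"
    by (simp add: MG_act_def lin_extend_scale)
  show "MG_act V id x = x"
    by (simp add: MG_act_def)
  show "MG_act V (\<tau> \<circ> \<sigma>) x = MG_act W \<tau> (MG_act V \<sigma> x)"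
    by (simp add: MG_act_def relabel_comp lin_extend_compose)
  assume x: "x \<in> MG V"
  show "MG_act V \<sigma> x \<in> MG W" if "bij_betw \<sigma> V W"
    unfolding MG_act_def using that
    by (intro MG_lin_extend[OF x]) (auto simp: bij_betw_def intro: relabel_closed)
  show "MG_act V \<sigma> x = MG_act V \<tau> x" if "\<And>v. v \<in> V \<Longrightarrow> \<sigma> v = \<tau> v"
    unfolding MG_act_def by (intro MG_lin_extend_cong[OF x]) (metis relabel_cong that)
qed

theorem theorem2p1:
  shows "operad
    (fscale :: 'k::field_char_0 \<Rightarrow> ('v or_multigraph \<times> 'v \<Rightarrow>\<^sub>0 'k) \<Rightarrow> 'v or_multigraph \<times> 'v \<Rightarrow>\<^sub>0 'k)
    MG MG_act MG_unit MG_pcomp"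
proof (intro operad.intro species_MG operad_axioms.intro)
  fix V V1 V2 V3 W1 W2 :: "'v set" and s s1 s2 s' v :: 'v and \<sigma> \<tau> :: "'v \<Rightarrow> 'v" and c :: 'k
    and x x' y y' z :: "'v or_multigraph \<times> 'v \<Rightarrow>\<^sub>0 'k"
  show "MG {} = {0 :: 'v or_multigraph \<times> 'v \<Rightarrow>\<^sub>0 'k}"
    by (auto simp: MG_def pointed_or_multigraphs_def)
  show "MG_unit v \<in> MG {v}"
    by (simp add: MG_unit_def MG_def pointed_or_multigraphs_def or_multigraphs_def)
  show "MG_act {v} \<sigma> (MG_unit v) = MG_unit (\<sigma> v)"
    by (simp add: MG_act_def MG_unit_def relabel_def)
  show "MG_pcomp V1 V2 s (x + x') y = MG_pcomp V1 V2 s x y + MG_pcomp V1 V2 s x' y"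
    by (simp add: MG_pcomp_def bilin_extend_add_left)
  show "MG_pcomp V1 V2 s (fscale c x) y = fscale c (MG_pcomp V1 V2 s x y)"
    by (simp add: MG_pcomp_def bilin_extend_scale_left)
  show "MG_pcomp V1 V2 s x (y + y') = MG_pcomp V1 V2 s x y + MG_pcomp V1 V2 s x y'"
    by (simp add: MG_pcomp_def bilin_extend_add_right)
  show "MG_pcomp V1 V2 s x (fscale c y) = fscale c (MG_pcomp V1 V2 s x y)"
    by (simp add: MG_pcomp_def bilin_extend_scale_right)
  show "MG_pcomp V1 V2 s x y \<in> MG (V1 \<union> V2)"
    if x: "x \<in> MG (insert s V1)" and y: "y \<in> MG V2"
    unfolding MG_pcomp_def bilin_extend_def
    by (rule MG_lin_extend[OF x], rule MG_lin_extend[OF y, unfolded MG_def mem_Collect_eq])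
      (rule graph_pcomp_closed)
  show "MG_act (V1 \<union> V2) (\<lambda>v. if v \<in> V1 then \<sigma> v else \<tau> v) (MG_pcomp V1 V2 s x y)
      = MG_pcomp W1 W2 s' (MG_act (insert s V1) \<sigma> x) (MG_act V2 \<tau> y)"
    if "composable V1 V2 s" "composable W1 W2 s'" "bij_betw \<sigma> V1 W1" "\<sigma> s = s'"
      "bij_betw \<tau> V2 W2" and x: "x \<in> MG (insert s V1)" and y: "y \<in> MG V2"
  proof -
    have "MG_act (V1 \<union> V2) (\<lambda>v. if v \<in> V1 then \<sigma> v else \<tau> v) (MG_pcomp V1 V2 s x y)
        = lin_extend (\<lambda>a. lin_extend (\<lambda>b. MG_act (V1 \<union> V2)
            (\<lambda>v. if v \<in> V1 then \<sigma> v else \<tau> v) (graph_pcomp V2 s a b)) y) x"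
      by (simp add: MG_pcomp_def bilin_extend_def MG_act_def lin_extend_compose)
    also have "\<dots> = lin_extend (\<lambda>a. lin_extend (\<lambda>b.
        graph_pcomp W2 s' (relabel \<sigma> a) (relabel \<tau> b)) y) x"
      using that(1-5)
      by (intro MG_lin_extend_cong[OF x] MG_lin_extend_cong[OF y]) (rule graph_pcomp_natural)
    also have "\<dots> = MG_pcomp W1 W2 s' (MG_act (insert s V1) \<sigma> x) (MG_act V2 \<tau> y)"
      by (simp add: MG_pcomp_def bilin_extend_def MG_act_def lin_extend_compose)
    finally show ?thesis .
  qed
  show "MG_pcomp (V1 \<union> V2) V3 s2 (MG_pcomp (insert s2 V1) V2 s1 x y) z
      = MG_pcomp (V1 \<union> V3) V2 s1 (MG_pcomp (insert s1 V1) V3 s2 x z) y"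
    if "finite V2" "finite V3" "s1 \<noteq> s2" "s1 \<notin> V1 \<union> V2 \<union> V3" "s2 \<notin> V1 \<union> V2 \<union> V3"
      and y: "y \<in> MG V2" and z: "z \<in> MG V3"
  proof -
    have "lin_extend (\<lambda>b. lin_extend (\<lambda>c.
          bilin_extend (graph_pcomp V3 s2) (graph_pcomp V2 s1 a b) (basis_vec c)) z) y
        = lin_extend (\<lambda>b. lin_extend (\<lambda>c.
          bilin_extend (graph_pcomp V2 s1) (graph_pcomp V3 s2 a c) (basis_vec b)) z) y"
      for a :: "'v or_multigraph \<times> 'v"
      using that(1-5)
      by (intro MG_lin_extend_cong[OF y] MG_lin_extend_cong[OF z])
        (rule graph_pcomp_parallel, auto)
    \<comment> \<open>The two sides expand \<open>y\<close> and \<open>z\<close> in opposite orders,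
      which \<open>lin_extend_swap\<close> reconciles.\<close>
    then show ?thesis
      unfolding MG_pcomp_def bilin_extend_bilin_left by (simp only: lin_extend_swap[of _ z y])
  qed
  show "MG_pcomp (V1 \<union> V2) V3 s2 (MG_pcomp V1 (insert s2 V2) s1 x y) z
      = MG_pcomp V1 (V2 \<union> V3) s1 x (MG_pcomp V2 V3 s2 y z)"
    if "finite V2" "finite V3" "V2 \<inter> V3 = {}" "s1 \<noteq> s2" "s1 \<notin> V1 \<union> V2 \<union> V3" "s2 \<notin> V1 \<union> V2 \<union> V3"
      and x: "x \<in> MG (insert s1 V1)" and y: "y \<in> MG (insert s2 V2)" and z: "z \<in> MG V3"
    unfolding MG_pcomp_def bilin_extend_bilin_left bilin_extend_bilin_right
    using that(1-6)
    by (intro MG_lin_extend_cong[OF x] MG_lin_extend_cong[OF y] MG_lin_extend_cong[OF z])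
      (rule graph_pcomp_sequential)
  show "MG_pcomp V {v} s x (MG_unit v) = MG_act (insert s V) (id(s := v)) x"
    if x: "x \<in> MG (insert s V)"
  proof -
    \<comment> \<open>Over a single vertex loose sources and loose targets alike can only go to
      \<open>v\<close>, so the substitution has singleton values and is a relabelling.\<close>
    have "graph_pcomp {v} s b ({#}, v) = (basis_vec (relabel (id(s := v)) b) :: _ \<Rightarrow>\<^sub>0 'k)" for b
    proof -
      have "subst_graph (end_choices s {v} v) g
          = (subst_graph (\<lambda>a. {#map_prod (id(s := v)) id a#}) g :: _ \<Rightarrow>\<^sub>0 'k)" for g
      proof -
        have "end_choices s {v} v (u, l) = {#map_prod (id(s := v)) id (u, l)#}" for u l
          by (cases l) (auto simp: end_choices_def)
        then show ?thesis by (metis surj_pair)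
      qed
      then show ?thesis
        by (cases b) (simp add: graph_pcomp_eq relabel_def subst_graph_singleton)
    qed
    then show ?thesis
      by (simp add: MG_pcomp_def MG_unit_def bilin_extend_def MG_act_def)
  qed
  show "MG_pcomp {} V s (MG_unit s) x = x" if "composable {} V s"
  proof -
    \<comment> \<open>The edgeless graph substitutes to \<open>1\<close>, and its root
      \<open>s\<close> gives way to the root of the inserted graph.\<close>
    have "graph_pcomp V s ({#}, s) = (basis_vec :: _ \<Rightarrow> _ \<Rightarrow>\<^sub>0 'k)"
      using that by (auto simp: fun_eq_iff graph_pcomp_eq composable_def)
    then show ?thesis
      by (simp add: MG_pcomp_def MG_unit_def bilin_extend_def)
  qed
qed

end
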